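(* Let $d\ge 1$, let $K=\{\mathbf{y}\in\mathbb{R}^d:\|\mathbf{y}\|_2\le 1\}$ be the unit ball, and let $\Lambda_1$ be the Lebesgue constant on $K$ for degree one interpolation at the $d+1$ points given by the rows of the matrix $X_d$ (vertices of a regular simplex inscribed in the unit sphere). Then $$\sqrt{d}\le \Lambda_1\le\sqrt{d+1}.$$
   Context: The matrices $X_d\in\mathbb{R}^{(d+1)\times d}$ are defined recursively by $X_1=\begin{bmatrix}-1\\ 1\end{bmatrix}$ and, for $d>1$, $$X_d=\begin{bmatrix} R_dX_{d-1} & -\frac1d\mathbf{1}_d\\ \mathbf{0}_{d-1}^t & 1\end{bmatrix},\qquad R_d=\frac{\sqrt{d^2-1}}{d},$$ where $\mathbf{1}_d\in\mathbb{R}^d$ is the all-ones column vector and $\mathbf{0}_{d-1}\in\mathbb{R}^{d-1}$ is the zero column vector. The rows of $X_d$, denoted $\mathbf{x}_1,\dots,\mathbf{x}_{d+1}$, are regarded as points of $\mathbb{R}^d$. The fundamental Lagrange polynomials $\ell_1,\dots,\ell_{d+1}$ are the unique polynomials of degree at most one on $\mathbb{R}^d$ with $\ell_i(\mathbf{x}_j)=\delta_{ij}$, and the Lebesgue constant is $\Lambda_1:=\max_{\mathbf{y}\in K}\sum_{i=1}^{d+1}|\ell_i(\mathbf{y})|$. *)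

theory Defs
  imports Complex_Main "HOL-Library.FuncSet" "Jordan_Normal_Form.Matrix"
begin

text \<open>Rows and nodes are numbered from 0, so the points
  $\mathbf{x}_1,\dots,\mathbf{x}_{d+1}$ are the rows 0, ..., d. The value at 0 is irrelevant.\<close>

fun simplex_mat :: "nat \<Rightarrow> real mat" where
  "simplex_mat 0 = 0\<^sub>m 1 0"
| "simplex_mat (Suc 0) = mat_of_rows_list 1 [[-1], [1]]"
| "simplex_mat (Suc (Suc n)) =
    (let d = Suc (Suc n) in
     four_block_mat
       ((sqrt ((real d)\<^sup>2 - 1) / real d) \<cdot>\<^sub>m simplex_mat (d - 1)) (mat d 1 (\<lambda>_. - 1 / real d))
       (0\<^sub>m 1 (d - 1))                                          (mat 1 1 (\<lambda>_. 1)))"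

text \<open>Polynomials of degree at most one are taken as polynomial functions. They are made
  extensional on $\mathbb{R}^d$, represented by \<^term>\<open>carrier_vec d\<close>, since otherwise the
  interpolating polynomial would not be unique as a function on the whole vector type.\<close>

definition polys_deg_le_1 :: "nat \<Rightarrow> (real vec \<Rightarrow> real) set" where
  "polys_deg_le_1 d = {\<lambda>y\<in>carrier_vec d. c + a \<bullet> y | c a. a \<in> carrier_vec d}"

definition lagrange_poly :: "nat \<Rightarrow> (nat \<Rightarrow> real vec) \<Rightarrow> nat \<Rightarrow> real vec \<Rightarrow> real" where
  "lagrange_poly d x i =
    (THE p. p \<in> polys_deg_le_1 d \<and> (\<forall>j<d + 1. p (x j) = (if i = j then 1 else 0)))"

definition unit_ball_vec :: "nat \<Rightarrow> real vec set" where
  "unit_ball_vec d = {y \<in> carrier_vec d. sqrt (y \<bullet> y) \<le> 1}"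

text \<open>The maximum is over an infinite set, so it is \<^const>\<open>Greatest\<close> rather than \<^const>\<open>Max\<close>.\<close>

definition lebesgue_constant :: "nat \<Rightarrow> real vec set \<Rightarrow> (nat \<Rightarrow> real vec) \<Rightarrow> real" where
  "lebesgue_constant d K x =
    (GREATEST v. v \<in> (\<lambda>y. \<Sum>i<d + 1. \<bar>lagrange_poly d x i y\<bar>) ` K)"

end

theory Submission
  imports Defs "HOL-Analysis.L2_Norm"
begin

text \<open>The nodes satisfy $\mathbf{x}_i \cdot \mathbf{x}_j = -1/d$ for $i \neq j$, so
  $\ell_i(\mathbf{y}) = (1 + d\,\mathbf{x}_i\cdot\mathbf{y})/(d+1)$. Fixing the set $S$ of indices
  where $\ell_i$ is negative turns $\sum_i |\ell_i|$ into an affine function, whose maximum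
  on the ball is explicit and depends only on $k = |S|$. With $n = d+1$ the Lebesgue constant is
  therefore the maximum of $(n - 2k + 2\sqrt{d\,k(n-k)})/n$ over $0 \le k \le n$. The upper bound
  is Cauchy--Schwarz, and the lower bound follows by taking $k = \lfloor n/2\rfloor$.\<close>

section \<open>Entries, columns and rows of the simplex matrix\<close>

lemma simplex_mat_carrier [simp]: "simplex_mat d \<in> carrier_mat (d + 1) d"
proof (induction d rule: simplex_mat.induct)
  case 2
  show ?case by (simp add: mat_of_rows_list_def)
next
  case (3 n)
  then show ?case by (auto simp: Let_def)
qed simp

lemma dim_simplex_mat [simp]:
  "dim_row (simplex_mat d) = d + 1" "dim_col (simplex_mat d) = d"
  using simplex_mat_carrier[of d] by (simp_all only: carrier_mat_def mem_Collect_eq)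

lemma simplex_mat_1_index:
  assumes "i < 2"
  shows "simplex_mat (Suc 0) $$ (i, 0) = (if i = 0 then -1 else 1)"
  using assms by (auto simp: mat_of_rows_list_def less_2_cases_iff)

lemma simplex_mat_Suc_index:
  assumes "d > 0" "i < d + 2" "k < d + 1"
  shows "simplex_mat (Suc d) $$ (i, k) =
    (if i < d + 1 then
       if k < d then sqrt ((real d + 1)\<^sup>2 - 1) / (real d + 1) * simplex_mat d $$ (i, k)
       else - 1 / (real d + 1)
     else if k < d then 0 else 1)"
proof -
  obtain m where "d = Suc m" using assms(1) gr0_implies_Suc by blast
  then show ?thesis using assms by (auto simp: Let_def add.commute)
qed

text \<open>From here on entries are reached only through the two index lemmas, so the block form
  must stay folded.\<close>

declare simplex_mat.simps(2,3) [simp del]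

text \<open>Products of two scaled entries contain the scaling factor only through its square, which
  is rational.\<close>

lemma scaling_factor_square:
  "(sqrt ((real d + 1)\<^sup>2 - 1) / (real d + 1))\<^sup>2 = real d * (real d + 2) / (real d + 1)\<^sup>2"
proof -
  have "(real d + 1)\<^sup>2 - 1 = real d * (real d + 2)"
    by (simp add: power2_eq_square algebra_simps)
  then show ?thesis by (simp add: power_divide)
qed

text \<open>Says that the barycentre of the nodes is the origin. Passing from \<open>d\<close> to
  \<open>d + 1\<close>, an old column is scaled and extended by 0, while the new one has
  \<open>d + 1\<close> entries \<open>- 1 / (d + 1)\<close> balanced by a single 1.\<close>

lemma simplex_mat_col_sum:
  assumes "k < d"
  shows "(\<Sum>i<d + 1. simplex_mat d $$ (i, k)) = 0"
  using assms
proof (induction d arbitrary: k)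
  case (Suc d)
  show ?case
  proof (cases "d = 0")
    case True
    with Suc.prems show ?thesis by (simp add: simplex_mat_1_index)
  next
    case False
    define R where "R = sqrt ((real d + 1)\<^sup>2 - 1) / (real d + 1)"
    have "(\<Sum>i<Suc d + 1. simplex_mat (Suc d) $$ (i, k)) =
      (\<Sum>i<d + 1. if k < d then R * simplex_mat d $$ (i, k) else - 1 / (real d + 1))
      + (if k < d then 0 else 1)"
      using False Suc.prems by (simp add: simplex_mat_Suc_index R_def)
    also have "\<dots> = 0"
    proof (cases "k < d")
      case True
      have "(\<Sum>i<d + 1. R * simplex_mat d $$ (i, k)) = 0"
        unfolding sum_distrib_left[symmetric] Suc.IH[OF True] by simp
      with True show ?thesis by simp
    qed simp
    finally show ?thesis .
  qed
qed simp

text \<open>The nodes form a tight frame. In the induction step the factor \<open>R\<^sup>2\<close>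
  turns (d+1)/d into (d+2)/(d+1) for old columns. An old column is orthogonal to the new one because
  the new one is constant wherever the old one can be nonzero, and old columns sum to 0.\<close>

lemma simplex_mat_col_orthogonal:
  assumes "k < d" "l < d"
  shows "(\<Sum>i<d + 1. simplex_mat d $$ (i, k) * simplex_mat d $$ (i, l)) =
    (if k = l then (real d + 1) / real d else 0)"
  using assms
proof (induction d arbitrary: k l)
  case (Suc d)
  show ?case
  proof (cases "d = 0")
    case True
    with Suc.prems show ?thesis by (simp add: simplex_mat_1_index)
  next
    case False
    define R where "R = sqrt ((real d + 1)\<^sup>2 - 1) / (real d + 1)"
    define X where "X = simplex_mat d"
    have R: "R\<^sup>2 = real d * (real d + 2) / (real d + 1)\<^sup>2"
      unfolding R_def by (rule scaling_factor_square)
    have col: "(\<Sum>i<d + 1. X $$ (i, k)) = 0" if "k < d" for k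
      unfolding X_def by (rule simplex_mat_col_sum[OF that])
    have entry: "simplex_mat (Suc d) $$ (i, k) = (if k < d then R * X $$ (i, k) else - 1 / (real d + 1))"
      "simplex_mat (Suc d) $$ (d + 1, k) = (if k < d then 0 else 1)"
      if "i < d + 1" "k < Suc d" for i k
      using that False by (auto simp: simplex_mat_Suc_index R_def X_def)
    have split: "(\<Sum>i<Suc d + 1. simplex_mat (Suc d) $$ (i, k) * simplex_mat (Suc d) $$ (i, l)) =
      (\<Sum>i<d + 1. (if k < d then R * X $$ (i, k) else - 1 / (real d + 1)) *
                  (if l < d then R * X $$ (i, l) else - 1 / (real d + 1)))
      + (if k < d then 0 else 1) * (if l < d then 0 else 1)"
      (is "_ = ?rhs")
      using Suc.prems entry[of 0] entry(1) by simp
    consider "k < d" "l < d" | "k < d" "l = d" | "k = d" "l < d" | "k = d" "l = d"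
      using Suc.prems by linarith
    then show ?thesis
    proof cases
      case 1
      have "?rhs = R\<^sup>2 * (\<Sum>i<d + 1. X $$ (i, k) * X $$ (i, l))"
        using 1 by (simp add: sum_distrib_left power2_eq_square algebra_simps)
      also have "\<dots> = R\<^sup>2 * (if k = l then (real d + 1) / real d else 0)"
        using Suc.IH[OF 1] by (simp add: X_def)
      also have "\<dots> = (if k = l then (real (Suc d) + 1) / real (Suc d) else 0)"
        unfolding R using False by (simp add: power2_eq_square add.commute)
      finally show ?thesis using split by simp
    next
      case 2
      have "?rhs = (\<Sum>i<d + 1. (- R / (real d + 1)) * X $$ (i, k))"
        using 2 by (simp add: algebra_simps)
      also have "\<dots> = 0"
        unfolding sum_distrib_left[symmetric] col[OF 2(1)] by simp
      finally show ?thesis using split 2 by simp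
    next
      case 3
      have "?rhs = (\<Sum>i<d + 1. (- R / (real d + 1)) * X $$ (i, l))"
        using 3 by (simp add: algebra_simps)
      also have "\<dots> = 0"
        unfolding sum_distrib_left[symmetric] col[OF 3(2)] by simp
      finally show ?thesis using split 3 by simp
    next
      case 4
      have "?rhs = (real d + 1) * (1 / (real d + 1)) * (1 / (real d + 1)) + 1"
        using 4 by (simp add: add.commute)
      also have "\<dots> = (real (Suc d) + 1) / real (Suc d)"
        by (simp add: field_simps)
      finally show ?thesis using split 4 by simp
    qed
  qed
qed simp

text \<open>The nodes are unit vectors at equal mutual angles, that is, a regular simplex in the
  sphere. In the induction step two old rows have inner product \<open>R\<^sup>2\<close> times the
  old one plus 1/(d+1)^2; an old row meets the new row only in the last coordinate.\<close>

lemma simplex_mat_row_gram: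
  assumes "d > 0" "i < d + 1" "j < d + 1"
  shows "(\<Sum>k<d. simplex_mat d $$ (i, k) * simplex_mat d $$ (j, k)) =
    (if i = j then 1 else - 1 / real d)"
  using assms
proof (induction d arbitrary: i j)
  case (Suc d)
  show ?case
  proof (cases "d = 0")
    case True
    with Suc.prems simplex_mat_1_index[of i] simplex_mat_1_index[of j] show ?thesis
      by (auto simp: numeral_2_eq_2 less_Suc_eq)
  next
    case False
    define R where "R = sqrt ((real d + 1)\<^sup>2 - 1) / (real d + 1)"
    define X where "X = simplex_mat d"
    have R: "R\<^sup>2 = real d * (real d + 2) / (real d + 1)\<^sup>2"
      unfolding R_def by (rule scaling_factor_square)
    have entry: "simplex_mat (Suc d) $$ (i, k) = (if i < d + 1 then R * X $$ (i, k) else 0)"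
      "simplex_mat (Suc d) $$ (i, d) = (if i < d + 1 then - 1 / (real d + 1) else 1)"
      if "i < d + 2" "k < d" for i k
      using that False by (auto simp: simplex_mat_Suc_index R_def X_def)
    have split: "(\<Sum>k<Suc d. simplex_mat (Suc d) $$ (i, k) * simplex_mat (Suc d) $$ (j, k)) =
      (\<Sum>k<d. (if i < d + 1 then R * X $$ (i, k) else 0) *
              (if j < d + 1 then R * X $$ (j, k) else 0))
      + (if i < d + 1 then - 1 / (real d + 1) else 1) * (if j < d + 1 then - 1 / (real d + 1) else 1)"
      (is "_ = ?rhs")
      using Suc.prems False entry(2)[of _ 0] by (simp add: entry(1))
    show ?thesis
    proof (cases "i < d + 1 \<and> j < d + 1")
      case True
      have "?rhs = R\<^sup>2 * (\<Sum>k<d. X $$ (i, k) * X $$ (j, k)) + 1 / (real d + 1)\<^sup>2"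
        using True by (simp add: sum_distrib_left power2_eq_square algebra_simps)
      also have "(\<Sum>k<d. X $$ (i, k) * X $$ (j, k)) = (if i = j then 1 else - 1 / real d)"
        unfolding X_def using True False by (intro Suc.IH) auto
      also have "R\<^sup>2 * \<dots> + 1 / (real d + 1)\<^sup>2 = (if i = j then 1 else - 1 / (real d + 1))"
      proof (cases "i = j")
        case True
        have "real d * (real d + 2) + 1 = (real d + 1)\<^sup>2"
          by (simp add: power2_eq_square algebra_simps)
        then have "R\<^sup>2 + 1 / (real d + 1)\<^sup>2 = 1"
          by (simp add: R flip: add_divide_distrib)
        with True show ?thesis by simp
      next
        case ne: False
        have "R\<^sup>2 * (- 1 / real d) = - ((real d + 2) / (real d + 1)\<^sup>2)"
          using False by (simp add: R)
        then have "R\<^sup>2 * (- 1 / real d) + 1 / (real d + 1)\<^sup>2 = (1 - (real d + 2)) / (real d + 1)\<^sup>2"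
          by (simp only: diff_divide_distrib)
        also have "\<dots> = - (real d + 1) / ((real d + 1) * (real d + 1))"
          by (simp add: power2_eq_square)
        also have "\<dots> = - 1 / (real d + 1)"
          by (simp only: divide_minus_left) simp
        finally show ?thesis using ne by simp
      qed
      finally show ?thesis using split by (simp add: add.commute)
    next
      case False
      with Suc.prems split show ?thesis by (auto simp: less_Suc_eq add.commute)
    qed
  qed
qed simp

section \<open>Scalar products in coordinates\<close>

lemma scalar_prod_sum_lessThan:
  "w \<in> carrier_vec d \<Longrightarrow> v \<bullet> w = (\<Sum>k<d. v $ k * w $ k)"
  by (auto simp: scalar_prod_def lessThan_atLeast0)

lemma scalar_prod_Cauchy_Schwarz:
  fixes v w :: "real vec"
  assumes "v \<in> carrier_vec d" "w \<in> carrier_vec d"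
  shows "\<bar>v \<bullet> w\<bar> \<le> sqrt (v \<bullet> v) * sqrt (w \<bullet> w)"
proof -
  have "\<bar>v \<bullet> w\<bar> \<le> (\<Sum>k<d. \<bar>v $ k\<bar> * \<bar>w $ k\<bar>)"
    unfolding scalar_prod_sum_lessThan[OF assms(2)] by (rule sum_abs[THEN order_trans]) (simp add: abs_mult)
  also have "\<dots> \<le> L2_set (($) v) {..<d} * L2_set (($) w) {..<d}"
    by (rule L2_set_mult_ineq)
  finally show ?thesis
    using assms by (simp add: L2_set_def scalar_prod_sum_lessThan power2_eq_square)
qed

text \<open>For d >= 1 this is the maximum over the unit ball of the sum of the Lagrange polynomials
  with the sign flipped at \<open>k\<close> of the indices.\<close>

definition cap_value :: "nat \<Rightarrow> nat \<Rightarrow> real" where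
  "cap_value d k =
    (real d + 1 - 2 * real k + 2 * sqrt (real d * (real k * (real d + 1 - real k)))) / (real d + 1)"

text \<open>Up to the factor -2d/(d+1), this is the gradient of the sum of the Lagrange polynomials
  with signs flipped on \<open>S\<close>.\<close>

definition node_subsum :: "nat \<Rightarrow> nat set \<Rightarrow> real vec" where
  "node_subsum d S = vec d (\<lambda>k. \<Sum>i\<in>S. row (simplex_mat d) i $ k)"

section \<open>The nodes and their fundamental Lagrange polynomials\<close>

context
  fixes d :: nat and x :: "nat \<Rightarrow> real vec"
  assumes d: "d \<ge> 1"
  defines "x \<equiv> row (simplex_mat d)"
begin

lemma node_carrier [simp]: "x i \<in> carrier_vec d"
  unfolding x_def by (rule carrier_vecI) simp

lemma node_index: "i < d + 1 \<Longrightarrow> k < d \<Longrightarrow> x i $ k = simplex_mat d $$ (i, k)"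
  unfolding x_def by (rule index_row(1)) simp_all

lemma node_scalar_prod:
  assumes "y \<in> carrier_vec d"
  shows "x i \<bullet> y = (\<Sum>k<d. x i $ k * y $ k)"
  using assms by (rule scalar_prod_sum_lessThan)

lemma node_gram:
  assumes "i < d + 1" "j < d + 1"
  shows "x i \<bullet> x j = (if i = j then 1 else - 1 / real d)"
proof -
  have "x i \<bullet> x j = (\<Sum>k<d. simplex_mat d $$ (i, k) * simplex_mat d $$ (j, k))"
    unfolding node_scalar_prod[OF node_carrier] using assms
    by (intro sum.cong refl) (simp add: node_index)
  also have "\<dots> = (if i = j then 1 else - 1 / real d)"
    using assms d by (intro simplex_mat_row_gram) simp_all
  finally show ?thesis .
qed

lemma node_sum:
  assumes "k < d"
  shows "(\<Sum>i<d + 1. x i $ k) = 0"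
proof -
  have "(\<Sum>i<d + 1. x i $ k) = (\<Sum>i<d + 1. simplex_mat d $$ (i, k))"
    using assms by (intro sum.cong refl) (simp add: node_index)
  then show ?thesis by (simp only: simplex_mat_col_sum[OF assms])
qed

lemma node_tight_frame:
  assumes "k < d" "l < d"
  shows "(\<Sum>i<d + 1. x i $ k * x i $ l) = (if k = l then (real d + 1) / real d else 0)"
proof -
  have "(\<Sum>i<d + 1. x i $ k * x i $ l) =
      (\<Sum>i<d + 1. simplex_mat d $$ (i, k) * simplex_mat d $$ (i, l))"
    using assms by (intro sum.cong refl) (simp add: node_index)
  then show ?thesis by (simp only: simplex_mat_col_orthogonal[OF assms])
qed

lemma sum_node_scalar_prod:
  assumes "y \<in> carrier_vec d"
  shows "(\<Sum>i<d + 1. x i \<bullet> y) = 0"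
proof -
  have "(\<Sum>i<d + 1. x i \<bullet> y) = (\<Sum>k<d. \<Sum>i<d + 1. x i $ k * y $ k)"
    unfolding node_scalar_prod[OF assms] by (rule sum.swap)
  also have "\<dots> = 0"
    using node_sum by (intro sum.neutral) (simp del: sum.lessThan_Suc flip: sum_distrib_right)
  finally show ?thesis .
qed

text \<open>Uniqueness of degree one interpolation. Averaging over the nodes removes the linear
  part, since the barycentre is 0, and so yields the constant; the tight frame property then
  recovers the gradient.\<close>

lemma affine_determined_by_nodes:
  assumes "a \<in> carrier_vec d" "b \<in> carrier_vec d"
    and eq: "\<And>j. j < d + 1 \<Longrightarrow> c + a \<bullet> x j = c' + b \<bullet> x j"
  shows "c = c' \<and> a = b"
proof -
  have scal: "v \<bullet> x j = x j \<bullet> v" if "v \<in> carrier_vec d" for v j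
    using that by (intro comm_scalar_prod[of _ d]) simp_all
  have mean: "(\<Sum>j<d + 1. e + v \<bullet> x j) = (real d + 1) * e" if "v \<in> carrier_vec d" for v e
    by (simp only: sum.distrib scal[OF that] sum_node_scalar_prod[OF that]) simp
  have "(real d + 1) * c = (real d + 1) * c'"
    using mean[OF assms(1), of c] mean[OF assms(2), of c'] eq by simp
  then have c: "c = c'" by simp
  \<comment> \<open>Frame reconstruction: the vectors (v . x_j) x_j sum to (d+1)/d times v.\<close>
  have recover: "(\<Sum>j<d + 1. (v \<bullet> x j) * x j $ k) = (real d + 1) / real d * v $ k"
    if v: "v \<in> carrier_vec d" and k: "k < d" for v k
  proof -
    have "(\<Sum>j<d + 1. (v \<bullet> x j) * x j $ k) = (\<Sum>j<d + 1. \<Sum>l<d. x j $ l * v $ l * x j $ k)"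
      unfolding scal[OF v] node_scalar_prod[OF v] sum_distrib_right ..
    also have "\<dots> = (\<Sum>l<d. \<Sum>j<d + 1. x j $ l * v $ l * x j $ k)"
      by (rule sum.swap)
    also have "\<dots> = (\<Sum>l<d. v $ l * (\<Sum>j<d + 1. x j $ l * x j $ k))"
      unfolding sum_distrib_left by (intro sum.cong refl) (simp add: algebra_simps)
    also have "\<dots> = (\<Sum>l<d. if l = k then (real d + 1) / real d * v $ l else 0)"
      using node_tight_frame[OF _ k] by (intro sum.cong refl) (simp del: sum.lessThan_Suc)
    also have "\<dots> = (real d + 1) / real d * v $ k"
      using k by simp
    finally show ?thesis .
  qed
  have "a $ k = b $ k" if "k < d" for k
  proof -
    have "(\<Sum>j<d + 1. (a \<bullet> x j) * x j $ k) = (\<Sum>j<d + 1. (b \<bullet> x j) * x j $ k)"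
      using eq c by (intro sum.cong) auto
    then have "(real d + 1) / real d * a $ k = (real d + 1) / real d * b $ k"
      using recover[OF assms(1) that] recover[OF assms(2) that] by simp
    with d show ?thesis by simp
  qed
  then have "a = b" using assms(1,2) by (intro eq_vecI) auto
  with c show ?thesis by simp
qed

text \<open>The Gram values 1 and -1/d make this affine function equal 1 at its own node and 0 at
  the others; uniqueness of the interpolant then settles the definite description.\<close>

lemma lagrange_poly_simplex:
  assumes i: "i < d + 1"
  shows "lagrange_poly d x i = (\<lambda>y\<in>carrier_vec d. (1 + real d * (x i \<bullet> y)) / (real d + 1))"
  unfolding lagrange_poly_def
proof (rule the_equality)
  define a where "a = (real d / (real d + 1)) \<cdot>\<^sub>v x i"
  define L where "L = (\<lambda>y\<in>carrier_vec d. (1 + real d * (x i \<bullet> y)) / (real d + 1))"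
  have a: "a \<in> carrier_vec d" by (simp add: a_def)
  have L: "L = (\<lambda>y\<in>carrier_vec d. 1 / (real d + 1) + a \<bullet> y)"
    unfolding L_def a_def
    by (intro restrict_ext) (simp add: add_divide_distrib)
  have val: "L (x j) = (if i = j then 1 else 0)" if "j < d + 1" for j
    using i that d by (simp add: L_def node_gram)
  show L_ok: "L \<in> polys_deg_le_1 d \<and> (\<forall>j<d + 1. L (x j) = (if i = j then 1 else 0))"
    using L a val unfolding polys_deg_le_1_def by blast
  fix p assume p: "p \<in> polys_deg_le_1 d \<and> (\<forall>j<d + 1. p (x j) = (if i = j then 1 else 0))"
  then obtain c b where b: "b \<in> carrier_vec d" and pb: "p = (\<lambda>y\<in>carrier_vec d. c + b \<bullet> y)"
    unfolding polys_deg_le_1_def by blast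
  have "c + b \<bullet> x j = 1 / (real d + 1) + a \<bullet> x j" if "j < d + 1" for j
  proof -
    have "p (x j) = L (x j)" using p val that by simp
    then show ?thesis by (simp add: L pb)
  qed
  then have "c = 1 / (real d + 1) \<and> b = a"
    using affine_determined_by_nodes[OF b a] by blast
  then show "p = L" by (simp add: pb L)
qed

section \<open>Signed sums of Lagrange polynomials and the Lebesgue constant\<close>

lemma node_subsum_carrier [simp]: "node_subsum d S \<in> carrier_vec d"
  by (simp add: node_subsum_def)

lemma node_subsum_scalar_prod:
  assumes "y \<in> carrier_vec d"
  shows "node_subsum d S \<bullet> y = (\<Sum>i\<in>S. x i \<bullet> y)"
proof -
  have "node_subsum d S \<bullet> y = (\<Sum>k<d. \<Sum>i\<in>S. x i $ k * y $ k)"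
    unfolding scalar_prod_sum_lessThan[OF assms] x_def
    by (intro sum.cong refl) (simp add: node_subsum_def sum_distrib_right)
  also have "\<dots> = (\<Sum>i\<in>S. \<Sum>k<d. x i $ k * y $ k)"
    by (rule sum.swap)
  finally show ?thesis by (simp add: node_scalar_prod[OF assms])
qed

text \<open>Expands into a double sum of Gram entries, so only the size of \<open>S\<close>
  matters.\<close>

lemma node_subsum_norm:
  assumes S: "S \<subseteq> {..<d + 1}"
  shows "node_subsum d S \<bullet> node_subsum d S = real (card S) * (real d + 1 - real (card S)) / real d"
proof -
  have fin: "finite S" using S finite_subset by blast
  have "node_subsum d S \<bullet> node_subsum d S = (\<Sum>i\<in>S. \<Sum>j\<in>S. x j \<bullet> x i)"
    by (simp add: node_subsum_scalar_prod comm_scalar_prod[of "x _" d "node_subsum d S"])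
  also have "\<dots> = (\<Sum>i\<in>S. (1 + real d) / real d - real (card S) / real d)"
  proof (intro sum.cong refl)
    fix i assume "i \<in> S"
    \<comment> \<open>The Gram entry is written as a multiple of the Kronecker delta minus the
      constant 1/d, so that the sum over \<open>j\<close> splits.\<close>
    have "(\<Sum>j\<in>S. x j \<bullet> x i) = (\<Sum>j\<in>S. (if j = i then (1 + real d) / real d else 0) - 1 / real d)"
      using S \<open>i \<in> S\<close> d by (intro sum.cong refl) (auto simp: node_gram subset_iff field_simps)
    also have "\<dots> = (1 + real d) / real d - real (card S) / real d"
      using fin \<open>i \<in> S\<close> by (simp add: sum_subtractf)
    finally show "(\<Sum>j\<in>S. x j \<bullet> x i) = (1 + real d) / real d - real (card S) / real d" .
  qed
  also have "\<dots> = real (card S) * (real d + 1 - real (card S)) / real d"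
    by (simp add: algebra_simps flip: diff_divide_distrib)
  finally show ?thesis .
qed

text \<open>The Lagrange polynomials sum to 1 because the nodes sum to 0, so flipping the signs on
  \<open>S\<close> subtracts twice the partial sum over \<open>S\<close>.\<close>

lemma signed_sum:
  assumes S: "S \<subseteq> {..<d + 1}" and y: "y \<in> carrier_vec d"
  defines "L i \<equiv> (1 + real d * (x i \<bullet> y)) / (real d + 1)"
  shows "(\<Sum>i<d + 1. if i \<in> S then - L i else L i) =
    (real d + 1 - 2 * real (card S) - 2 * real d * (node_subsum d S \<bullet> y)) / (real d + 1)"
proof -
  have "(\<Sum>i<d + 1. if i \<in> S then - L i else L i) = (\<Sum>i<d + 1. L i - (if i \<in> S then 2 * L i else 0))"
    by (intro sum.cong) auto
  also have "\<dots> = (\<Sum>i<d + 1. L i) - 2 * (\<Sum>i\<in>S. L i)"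
    unfolding sum_subtractf sum_distrib_left using S
    by (subst sum.inter_restrict[symmetric]) (simp_all only: finite_lessThan Int_absorb1)
  also have "(\<Sum>i<d + 1. L i) = 1"
    unfolding L_def sum_divide_distrib[symmetric] sum.distrib sum_distrib_left[symmetric]
      sum_node_scalar_prod[OF y] by simp
  also have "(\<Sum>i\<in>S. L i) = (real (card S) + real d * (node_subsum d S \<bullet> y)) / (real d + 1)"
    unfolding L_def sum_divide_distrib[symmetric] sum.distrib sum_distrib_left[symmetric]
      node_subsum_scalar_prod[OF y] by simp
  also have "1 - 2 * ((real (card S) + real d * (node_subsum d S \<bullet> y)) / (real d + 1)) =
    (real d + 1 - 2 * real (card S) - 2 * real d * (node_subsum d S \<bullet> y)) / (real d + 1)"
  proof -
    have "b \<noteq> 0 \<Longrightarrow> 1 - 2 * (a / b) = (b - 2 * a) / b" for a b :: real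
      by (simp add: diff_divide_distrib)
    from this[of "real d + 1" "real (card S) + real d * (node_subsum d S \<bullet> y)"]
    show ?thesis by (simp add: distrib_left mult.assoc)
  qed
  finally show ?thesis .
qed

lemma cap_value_subsum:
  assumes S: "S \<subseteq> {..<d + 1}"
  shows "cap_value d (card S) =
    (real d + 1 - 2 * real (card S) + 2 * real d * sqrt (node_subsum d S \<bullet> node_subsum d S)) / (real d + 1)"
proof -
  have "real d * sqrt (t / real d) = sqrt (real d * t)" for t
    using d by (simp add: real_sqrt_divide real_sqrt_mult real_div_sqrt field_simps)
  then show ?thesis
    unfolding cap_value_def node_subsum_norm[OF S] by (simp add: algebra_simps)
qed

text \<open>With \<open>S\<close> the set of indices where the Lagrange polynomial is negative at
  \<open>y\<close>, the sum of absolute values is a signed sum, and Cauchy-Schwarz bounds its linear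
  part.\<close>

lemma sum_abs_lagrange_le:
  assumes y: "y \<in> unit_ball_vec d"
  shows "\<exists>k\<le>d + 1. (\<Sum>i<d + 1. \<bar>lagrange_poly d x i y\<bar>) \<le> cap_value d k"
proof -
  define L where "L i = (1 + real d * (x i \<bullet> y)) / (real d + 1)" for i
  define S where "S = {i. i < d + 1 \<and> L i < 0}"
  have S: "S \<subseteq> {..<d + 1}" by (auto simp: S_def)
  have yc: "y \<in> carrier_vec d" and yn: "sqrt (y \<bullet> y) \<le> 1"
    using y by (auto simp: unit_ball_vec_def)
  have "0 \<le> node_subsum d S \<bullet> node_subsum d S"
    by (simp add: scalar_prod_sum_lessThan[of _ d] sum_nonneg)
  \<comment> \<open>Cauchy-Schwarz leaves the factor \<open>sqrt (y \<bullet> y)\<close>, which is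
    at most 1 on the ball.\<close>
  then have "- (node_subsum d S \<bullet> y) \<le> sqrt (node_subsum d S \<bullet> node_subsum d S)"
    using scalar_prod_Cauchy_Schwarz[OF node_subsum_carrier[of S] yc]
      mult_left_le[OF yn, of "sqrt (node_subsum d S \<bullet> node_subsum d S)"] by simp
  then have "- (2 * real d * (node_subsum d S \<bullet> y)) \<le>
      2 * real d * sqrt (node_subsum d S \<bullet> node_subsum d S)"
    using mult_left_mono[of _ _ "2 * real d"] by fastforce
  then have le: "(real d + 1 - 2 * real (card S) - 2 * real d * (node_subsum d S \<bullet> y)) / (real d + 1)
      \<le> cap_value d (card S)"
    unfolding cap_value_subsum[OF S] by (intro divide_right_mono) simp_all
  have lagrange: "lagrange_poly d x i y = L i" if "i < d + 1" for i
    using that yc by (simp add: lagrange_poly_simplex L_def)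
  have "(\<Sum>i<d + 1. \<bar>lagrange_poly d x i y\<bar>) = (\<Sum>i<d + 1. if i \<in> S then - L i else L i)"
    using lagrange by (intro sum.cong refl) (auto simp: S_def)
  also have "\<dots> \<le> cap_value d (card S)"
    unfolding L_def signed_sum[OF S yc] by (rule le)
  finally show ?thesis
    using card_mono[OF _ S] by auto
qed

text \<open>A signed sum never exceeds the sum of absolute values, so it suffices to maximise one
  with \<open>k\<close> flipped signs. The maximiser \<open>y\<close> points opposite to the partial
  sum \<open>w\<close> of the nodes; the first \<open>k\<close> indices serve as \<open>S\<close>,
  since only the size counts.\<close>

lemma sum_abs_lagrange_ge:
  assumes k: "k \<le> d + 1"
  shows "\<exists>y\<in>unit_ball_vec d. cap_value d k \<le> (\<Sum>i<d + 1. \<bar>lagrange_poly d x i y\<bar>)"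
proof -
  define S where "S = {..<k}"
  define w where "w = node_subsum d S"
  define r where "r = sqrt (w \<bullet> w)"
  define y where "y = (- (1 / r)) \<cdot>\<^sub>v w"
  have S: "S \<subseteq> {..<d + 1}" and card: "card S = k" using k by (auto simp: S_def)
  have w: "w \<in> carrier_vec d" by (simp add: w_def)
  have y: "y \<in> carrier_vec d" using w by (simp add: y_def)
  have "0 \<le> w \<bullet> w"
    by (simp add: scalar_prod_sum_lessThan[OF w] sum_nonneg)
  then have r: "w \<bullet> w = r * r" by (simp add: r_def)
  \<comment> \<open>These hold for $r = 0$ too, as then $1/r = 0$.\<close>
  have "w \<bullet> y = - r" using w r by (simp add: y_def)
  have "y \<bullet> y \<le> 1" using w r by (simp add: y_def)
  then have ball: "y \<in> unit_ball_vec d" using y by (simp add: unit_ball_vec_def)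
  define L where "L i = (1 + real d * (x i \<bullet> y)) / (real d + 1)" for i
  have lagrange: "lagrange_poly d x i y = L i" if "i < d + 1" for i
    using that y by (simp add: lagrange_poly_simplex L_def)
  have "cap_value d k = (\<Sum>i<d + 1. if i \<in> S then - L i else L i)"
    unfolding L_def signed_sum[OF S y] card[symmetric] cap_value_subsum[OF S]
    using \<open>w \<bullet> y = - r\<close> by (simp add: w_def r_def)
  also have "\<dots> \<le> (\<Sum>i<d + 1. \<bar>lagrange_poly d x i y\<bar>)"
    using lagrange by (intro sum_mono) auto
  finally show ?thesis using ball by blast
qed

text \<open>\<open>Greatest\<close> needs an attained upper bound: the upper estimate bounds every
  value, and the lower one, at an index \<open>k\<close> realising the finite maximum, gives a point
  that attains it.\<close>

lemma lebesgue_constant_simplex: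
  "lebesgue_constant d (unit_ball_vec d) x = Max (cap_value d ` {..d + 1})"
  (is "_ = ?M")
  unfolding lebesgue_constant_def
proof (rule Greatest_equality)
  let ?L = "\<lambda>y. \<Sum>i<d + 1. \<bar>lagrange_poly d x i y\<bar>"
  have upper: "?L y \<le> ?M" if "y \<in> unit_ball_vec d" for y
    using sum_abs_lagrange_le[OF that] by (meson Max_ge atMost_iff finite_atMost finite_imageI imageI order_trans)
  then show "v \<le> ?M" if "v \<in> ?L ` unit_ball_vec d" for v
    using that by blast
  have "?M \<in> cap_value d ` {..d + 1}"
    by (intro Max_in) auto
  then obtain k where "k \<le> d + 1" "?M = cap_value d k" by blast
  then obtain y where y: "y \<in> unit_ball_vec d" "?M \<le> ?L y"
    using sum_abs_lagrange_ge by metis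
  then have "?M = ?L y" using upper[of y] by (intro antisym)
  then show "?M \<in> ?L ` unit_ball_vec d"
    using y(1) by (rule image_eqI)
qed

end

section \<open>Numerical bounds for the cap values\<close>

lemma cap_value_le:
  assumes "k \<le> d + 1"
  shows "cap_value d k \<le> sqrt (real (d + 1))"
proof -
  define n where "n = real d + 1"
  define t where "t = real k * (n - real k)"
  have n: "n > 0" by (simp add: n_def)
  have "real k \<le> n" using assms by (simp add: n_def)
  then have t: "t \<ge> 0" by (simp add: t_def)
  \<comment> \<open>The two-square identity: its first square is exactly the defect in the
    Cauchy-Schwarz inequality used below.\<close>
  have id: "(r * u - 2 * s)\<^sup>2 + (u + 2 * (r * s))\<^sup>2 = (1 + r\<^sup>2) * (u\<^sup>2 + 4 * s\<^sup>2)" for r s u :: real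
    by (simp add: power2_eq_square algebra_simps)
  \<comment> \<open>Cauchy--Schwarz for $(n - 2k,\, 2\sqrt{k(n-k)})$ and $(1, \sqrt d)$\<close>
  have "0 \<le> (sqrt (real d) * (n - 2 * real k) - 2 * sqrt t)\<^sup>2" by simp
  also have "\<dots> = n * n\<^sup>2 - (n - 2 * real k + 2 * sqrt (real d * t))\<^sup>2"
  proof -
    have "(sqrt (real d) * (n - 2 * real k) - 2 * sqrt t)\<^sup>2 + (n - 2 * real k + 2 * (sqrt (real d) * sqrt t))\<^sup>2
      = (1 + (sqrt (real d))\<^sup>2) * ((n - 2 * real k)\<^sup>2 + 4 * (sqrt t)\<^sup>2)"
      by (rule id)
    \<comment> \<open>Here 1 + d = n and (n - 2k)^2 + 4k(n - k) = n^2.\<close>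
    also have "\<dots> = n * n\<^sup>2"
      using t by (simp add: t_def n_def power2_eq_square algebra_simps)
    finally show ?thesis by (simp add: real_sqrt_mult)
  qed
  finally have "(n - 2 * real k + 2 * sqrt (real d * t))\<^sup>2 \<le> n * n\<^sup>2" by simp
  then have "n - 2 * real k + 2 * sqrt (real d * t) \<le> sqrt (n * n\<^sup>2)"
    by (rule real_le_rsqrt)
  also have "\<dots> = sqrt n * n" using n by (simp add: real_sqrt_mult)
  finally have "(n - 2 * real k + 2 * sqrt (real d * t)) / n \<le> sqrt n"
    using n by (simp add: pos_divide_le_eq)
  then show ?thesis
    by (simp add: cap_value_def n_def t_def add.commute)
qed

text \<open>With n = d + 1 and m its parity, n - 2k = m and 4k(n - k) = n^2 - m^2. For even n the
  value is exactly sqrt d; for odd n the summand m = 1 makes up for the loss under the root.\<close>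

lemma cap_value_middle_ge:
  "sqrt (real d) \<le> cap_value d ((d + 1) div 2)"
proof -
  define n where "n = real d + 1"
  define m where "m = (d + 1) mod 2"
  define k where "k = (d + 1) div 2"
  have "2 * k + m = d + 1" unfolding k_def m_def by simp
  then have "real (2 * k + m) = real (d + 1)" by simp
  then have k: "2 * real k = n - real m" unfolding n_def by simp
  have n: "n \<ge> 1" by (simp add: n_def)
  have m: "real m = 0 \<or> real m = 1" by (auto simp: m_def)
  have "cap_value d k = (n - 2 * real k + 2 * sqrt (real d * (real k * (n - real k)))) / n"
    by (simp add: cap_value_def n_def)
  also have "n - 2 * real k = real m"
    using k by simp
  also have "2 * sqrt (real d * (real k * (n - real k))) = sqrt (4 * (real d * (real k * (n - real k))))"
    by (simp only: real_sqrt_mult real_sqrt_four)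
  also have "4 * (real d * (real k * (n - real k))) = real d * (n\<^sup>2 - (real m)\<^sup>2)"
  proof -
    have "4 * (real d * (real k * (n - real k))) = real d * (2 * real k * (2 * n - 2 * real k))"
      by (simp add: algebra_simps)
    also have "\<dots> = real d * (n\<^sup>2 - (real m)\<^sup>2)"
      unfolding k by (simp add: power2_eq_square algebra_simps)
    finally show ?thesis .
  qed
  finally have val: "cap_value d k = (real m + sqrt (real d) * sqrt (n\<^sup>2 - (real m)\<^sup>2)) / n"
    by (simp add: real_sqrt_mult)
  have "sqrt (real d) * n \<le> real m + sqrt (real d) * sqrt (n\<^sup>2 - (real m)\<^sup>2)"
    using m
  proof
    assume "real m = 1"
    define s where "s = sqrt (n\<^sup>2 - 1)"
    have s: "s \<ge> 0" "s\<^sup>2 = n\<^sup>2 - 1" using n by (simp_all add: s_def)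
    have "sqrt (real d) \<le> n"
      by (rule real_le_lsqrt) (simp_all add: n_def power2_eq_square algebra_simps)
    have "s \<le> n" using n by (intro power2_le_imp_le[of s n]) (simp_all add: s)
    \<comment> \<open>The loss sqrt d * (n - s) is at most 1, because (n + s)(n - s) = 1 and sqrt d
      <= n <= n + s.\<close>
    then have "sqrt (real d) * (n - s) \<le> (n + s) * (n - s)"
      using \<open>sqrt (real d) \<le> n\<close> s(1) by (intro mult_right_mono) auto
    also have "\<dots> = 1" using s(2) by (simp add: power2_eq_square algebra_simps)
    finally show ?thesis using \<open>real m = 1\<close> by (simp add: s_def algebra_simps)
  qed (use n in simp)
  then have "sqrt (real d) \<le> cap_value d k"
    using n by (simp add: val pos_le_divide_eq)
  then show ?thesis by (simp add: k_def)
qed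

theorem proposition2p6:
  fixes d :: nat
  assumes "d \<ge> 1"
  shows "sqrt (real d) \<le> lebesgue_constant d (unit_ball_vec d) (row (simplex_mat d))
    \<and> lebesgue_constant d (unit_ball_vec d) (row (simplex_mat d)) \<le> sqrt (real (d + 1))"
proof
  have "sqrt (real d) \<le> cap_value d ((d + 1) div 2)"
    by (rule cap_value_middle_ge)
  also have "\<dots> \<le> Max (cap_value d ` {..d + 1})"
    by (intro Max_ge imageI) auto
  finally show "sqrt (real d) \<le> lebesgue_constant d (unit_ball_vec d) (row (simplex_mat d))"
    by (simp only: lebesgue_constant_simplex[OF assms])
  show "lebesgue_constant d (unit_ball_vec d) (row (simplex_mat d)) \<le> sqrt (real (d + 1))"
    unfolding lebesgue_constant_simplex[OF assms] using cap_value_le[of _ d]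
    by (intro Max.boundedI) auto
qed

end
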